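(* Let $X$ be a classical Meixner random variable with parameters $\alpha,\alpha_0,\beta,t\in\mathbb{R}$, $t>0$, and let $U=a^-+\frac12 a^0$ and $V=a^++\frac12 a^0$ be its semi-annihilation and semi-creation operators. Put $\Delta=\alpha^2-4\beta$ and $\tau=2t-\alpha\alpha_0$. (i) If $\Delta=0$, then $$U=\frac{\alpha_0}{2}I+\frac12(\alpha X+\tau)D,\qquad V=\Big(X-\frac{\alpha_0}{2}\Big)I-\frac12(\alpha X+\tau)D .$$ (ii) If $\Delta\neq 0$ and $\delta\in\mathbb{C}$ is a square root of $\Delta$ ($\delta^2=\Delta$), then $$U=\frac{\alpha_0}{2}I-\frac14(X-\alpha_0)\big(\mathcal{T}_\delta+\mathcal{T}_{-\delta}-2I\big)+\frac1{4\delta}(\alpha X+\tau)\big(\mathcal{T}_\delta-\mathcal{T}_{-\delta}\big),$$ $$V=X-\frac{\alpha_0}{2}I+\frac14(X-\alpha_0)\big(\mathcal{T}_\delta+\mathcal{T}_{-\delta}-2I\big)-\frac1{4\delta}(\alpha X+\tau)\big(\mathcal{T}_\delta-\mathcal{T}_{-\delta}\big).$$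
   Context: Let $X$ be a real-valued random variable with finite moments of all orders on a probability space $(\Omega,\mathcal F,P)$. Let $F$ be the space of random variables $f(X)$ with $f\in\mathbb{C}[x]$, let $F_n$ be the subspace of those $f(X)$ with $\deg f\le n$, $F_{-1}=\{0\}$, and $G_n=F_n\ominus F_{n-1}$ (orthogonal complement in $L^2(\Omega,P)$). If $G_n\ne\{0\}$, let $f_n(X)$ be the unique element of $G_n$ with $f_n$ monic of degree $n$. If $G_n=\{0\}$, put $f_n(X)=0$; also $f_{-1}(X)=0$. There are real numbers $\alpha_n$, $\omega_n$ (the Szegő–Jacobi parameters of $X$) with $Xf_n(X)=f_{n+1}(X)+\alpha_nf_n(X)+\omega_nf_{n-1}(X)$ for $n\ge0$. The creation, preservation and annihilation operators $a^+,a^0,a^-:F\to F$ are the linear operators with $a^+f_n(X)=f_{n+1}(X)$, $a^0f_n(X)=\alpha_nf_n(X)$, $a^-f_n(X)=\omega_nf_{n-1}(X)$, so that multiplication by $X$ equals $a^++a^0+a^-$. $X$ is a classical Meixner random variable with parameters $\alpha,\alpha_0,\beta,t\in\mathbb{R}$ if its Szegő–Jacobi parameters are $\alpha_n=\alpha n+\alpha_0$ and $\omega_n=\beta n^2+(t-\beta)n$, where either ($\beta\ge0$ and $t\ge0$) or ($\beta<0$ and $t\in-\mathbb{N}\beta=\{-k\beta:k\in\mathbb N\}$). If $X$ takes exactly $K<\infty$ values (almost surely), the convention is $\omega_K=0$, and the formulas are required for $\alpha_n$ with $0\le n\le K-1$ and for $\omega_n$ with $1\le n\le K$; otherwise they are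 required for all $n\geq 0$ (for $\alpha_n$) and all $n\ge1$ (for $\omega_n$). Only $t>0$ is considered (for $t=0$, $X$ is constant). Operator notation: $I$ is the identity, $D=d/dx$ is differentiation, and for $c\in\mathbb{C}$, $\mathcal{T}_c$ is the translation operator $\mathcal{T}_cf(X)=f(X+c)$. A polynomial in $X$ written to the left of an operator denotes multiplication by it. An operator identity $T=\sum_j A_j(X)S_j$, where each $S_j$ is built from $D$ or translations, means: for every polynomial $f\in\mathbb{C}[x]$, $T(f(X))=\sum_jA_j(X)\,(S_jf)(X)$ almost surely, where the same polynomial $f$ is used in all terms of the right-hand side. *)

theory Defs
  imports "HOL-Probability.Probability" "HOL-Computational_Algebra.Polynomial"
begin

text \<open>
  Elements of \<open>L\<^sup>2\<close> are represented by functions on the sample space; equality of such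
  elements is almost sure equality.
\<close>

definition ae_eq :: "'a measure \<Rightarrow> ('a \<Rightarrow> complex) \<Rightarrow> ('a \<Rightarrow> complex) \<Rightarrow> bool" where
  "ae_eq M g h \<longleftrightarrow> (AE \<omega> in M. g \<omega> = h \<omega>)"

definition inner_L2 :: "'a measure \<Rightarrow> ('a \<Rightarrow> complex) \<Rightarrow> ('a \<Rightarrow> complex) \<Rightarrow> complex" where
  "inner_L2 M g h = (LINT \<omega>|M. g \<omega> * cnj (h \<omega>))"

definition poly_rv :: "('a \<Rightarrow> real) \<Rightarrow> complex poly \<Rightarrow> 'a \<Rightarrow> complex" where
  "poly_rv X p = (\<lambda>\<omega>. poly p (complex_of_real (X \<omega>)))"

definition F_space :: "('a \<Rightarrow> real) \<Rightarrow> ('a \<Rightarrow> complex) set" where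
  "F_space X = {poly_rv X p |p. True}"

text \<open>
  Indices are integers, so that \<open>F\<^sub>k = {0}\<close>, \<open>G\<^sub>k = {0}\<close> and \<open>f\<^sub>k = 0\<close> for \<open>k < 0\<close>.
  The zero polynomial is listed separately because its \<^const>\<open>degree\<close> is \<open>0\<close>.
\<close>

definition F_upto :: "('a \<Rightarrow> real) \<Rightarrow> int \<Rightarrow> ('a \<Rightarrow> complex) set" where
  "F_upto X k = {poly_rv X p |p. p = 0 \<or> int (degree p) \<le> k}"

definition G_space :: "'a measure \<Rightarrow> ('a \<Rightarrow> real) \<Rightarrow> int \<Rightarrow> ('a \<Rightarrow> complex) set" where
  "G_space M X k = {g \<in> F_upto X k. \<forall>h \<in> F_upto X (k - 1). inner_L2 M g h = 0}"

text \<open>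
  If \<open>G\<^sub>k\<close> is not the zero space, then \<open>X\<close> has more than \<open>k\<close> values, so not only the random
  variable \<open>f\<^sub>k(X)\<close> but also the polynomial \<open>f\<^sub>k\<close> is unique.
\<close>

definition orth_poly :: "'a measure \<Rightarrow> ('a \<Rightarrow> real) \<Rightarrow> int \<Rightarrow> complex poly" where
  "orth_poly M X k =
    (if \<forall>g \<in> G_space M X k. ae_eq M g (\<lambda>_. 0) then 0
     else (THE p. lead_coeff p = 1 \<and> int (degree p) = k \<and> poly_rv X p \<in> G_space M X k))"

definition orth_rv :: "'a measure \<Rightarrow> ('a \<Rightarrow> real) \<Rightarrow> int \<Rightarrow> 'a \<Rightarrow> complex" where
  "orth_rv M X k = poly_rv X (orth_poly M X k)"

text \<open>
  If \<open>X\<close> has exactly \<open>K\<close> values, this condition leaves \<open>a n\<close> for \<open>n \<ge> K\<close> and \<open>w n\<close> for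
  \<open>n > K\<close> undetermined (all terms vanish) and forces \<open>w K = 0\<close>. The number \<open>w 0\<close> is always
  undetermined.
\<close>

definition szego_jacobi ::
    "'a measure \<Rightarrow> ('a \<Rightarrow> real) \<Rightarrow> (nat \<Rightarrow> real) \<Rightarrow> (nat \<Rightarrow> real) \<Rightarrow> bool" where
  "szego_jacobi M X a w \<longleftrightarrow>
    (\<forall>n. ae_eq M (\<lambda>\<omega>. complex_of_real (X \<omega>) * orth_rv M X (int n) \<omega>)
      (\<lambda>\<omega>. orth_rv M X (int n + 1) \<omega> + complex_of_real (a n) * orth_rv M X (int n) \<omega>
            + complex_of_real (w n) * orth_rv M X (int n - 1) \<omega>))"

definition linear_op_on_F ::
    "'a measure \<Rightarrow> ('a \<Rightarrow> real) \<Rightarrow> (('a \<Rightarrow> complex) \<Rightarrow> 'a \<Rightarrow> complex) \<Rightarrow> bool" where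
  "linear_op_on_F M X T \<longleftrightarrow>
    (\<forall>g \<in> F_space X. T g \<in> F_space X) \<and>
    (\<forall>g \<in> F_space X. \<forall>h \<in> F_space X. ae_eq M g h \<longrightarrow> ae_eq M (T g) (T h)) \<and>
    (\<forall>g \<in> F_space X. \<forall>h \<in> F_space X.
       ae_eq M (T (\<lambda>\<omega>. g \<omega> + h \<omega>)) (\<lambda>\<omega>. T g \<omega> + T h \<omega>)) \<and>
    (\<forall>c. \<forall>g \<in> F_space X. ae_eq M (T (\<lambda>\<omega>. c * g \<omega>)) (\<lambda>\<omega>. c * T g \<omega>))"

definition creation_op ::
    "'a measure \<Rightarrow> ('a \<Rightarrow> real) \<Rightarrow> (('a \<Rightarrow> complex) \<Rightarrow> 'a \<Rightarrow> complex) \<Rightarrow> bool" where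
  "creation_op M X T \<longleftrightarrow> linear_op_on_F M X T \<and>
    (\<forall>n::nat. ae_eq M (T (orth_rv M X (int n))) (orth_rv M X (int n + 1)))"

definition preservation_op ::
    "'a measure \<Rightarrow> ('a \<Rightarrow> real) \<Rightarrow> (nat \<Rightarrow> real) \<Rightarrow> (('a \<Rightarrow> complex) \<Rightarrow> 'a \<Rightarrow> complex) \<Rightarrow> bool" where
  "preservation_op M X a T \<longleftrightarrow> linear_op_on_F M X T \<and>
    (\<forall>n. ae_eq M (T (orth_rv M X (int n))) (\<lambda>\<omega>. complex_of_real (a n) * orth_rv M X (int n) \<omega>))"

definition annihilation_op ::
    "'a measure \<Rightarrow> ('a \<Rightarrow> real) \<Rightarrow> (nat \<Rightarrow> real) \<Rightarrow> (('a \<Rightarrow> complex) \<Rightarrow> 'a \<Rightarrow> complex) \<Rightarrow> bool" where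
  "annihilation_op M X w T \<longleftrightarrow> linear_op_on_F M X T \<and>
    (\<forall>n. ae_eq M (T (orth_rv M X (int n)))
      (\<lambda>\<omega>. complex_of_real (w n) * orth_rv M X (int n - 1) \<omega>))"

definition semi_annihilation ::
    "(('a \<Rightarrow> complex) \<Rightarrow> 'a \<Rightarrow> complex) \<Rightarrow> (('a \<Rightarrow> complex) \<Rightarrow> 'a \<Rightarrow> complex)
      \<Rightarrow> ('a \<Rightarrow> complex) \<Rightarrow> 'a \<Rightarrow> complex" where
  "semi_annihilation am az g = (\<lambda>\<omega>. am g \<omega> + 1/2 * az g \<omega>)"

definition semi_creation ::
    "(('a \<Rightarrow> complex) \<Rightarrow> 'a \<Rightarrow> complex) \<Rightarrow> (('a \<Rightarrow> complex) \<Rightarrow> 'a \<Rightarrow> complex)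
      \<Rightarrow> ('a \<Rightarrow> complex) \<Rightarrow> 'a \<Rightarrow> complex" where
  "semi_creation ap az g = (\<lambda>\<omega>. ap g \<omega> + 1/2 * az g \<omega>)"

definition takes_exactly :: "'a measure \<Rightarrow> ('a \<Rightarrow> real) \<Rightarrow> nat \<Rightarrow> bool" where
  "takes_exactly M X K \<longleftrightarrow>
    (\<exists>S. finite S \<and> card S = K \<and> (AE \<omega> in M. X \<omega> \<in> S) \<and>
      (\<forall>x \<in> S. measure M {\<omega> \<in> space M. X \<omega> = x} > 0))"

definition classical_meixner ::
    "'a measure \<Rightarrow> ('a \<Rightarrow> real) \<Rightarrow> real \<Rightarrow> real \<Rightarrow> real \<Rightarrow> real \<Rightarrow> bool" where
  "classical_meixner M X \<alpha> \<alpha>\<^sub>0 \<beta> t \<longleftrightarrow>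
    ((\<beta> \<ge> 0 \<and> t \<ge> 0) \<or> (\<beta> < 0 \<and> (\<exists>k::nat. t = - real k * \<beta>))) \<and>
    (\<exists>a w. szego_jacobi M X a w \<and>
      (\<forall>K. takes_exactly M X K \<longrightarrow>
        w K = 0 \<and>
        (\<forall>n<K. a n = \<alpha> * real n + \<alpha>\<^sub>0) \<and>
        (\<forall>n\<in>{1..K}. w n = \<beta> * (real n)\<^sup>2 + (t - \<beta>) * real n)) \<and>
      ((\<nexists>K. takes_exactly M X K) \<longrightarrow>
        (\<forall>n. a n = \<alpha> * real n + \<alpha>\<^sub>0) \<and>
        (\<forall>n\<ge>1. w n = \<beta> * (real n)\<^sup>2 + (t - \<beta>) * real n)))"

definition translate :: "complex \<Rightarrow> complex poly \<Rightarrow> complex poly" where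
  "translate c p = pcompose p [:c, 1:]"

end

theory Submission imports Defs begin

text \<open>
  Let \<open>N f\<^sub>n = n f\<^sub>n\<close> be the number operator. For Meixner parameters the commutators with
  multiplication by \<open>X\<close> close up: \<open>[U, X] = (\<alpha>X + \<tau>)/2 - (\<Delta>/2) N\<close> and \<open>[N, X] = X - 2U\<close>. Together
  with \<open>U 1 = \<alpha>\<^sub>0/2\<close> and \<open>N 1 = 0\<close> these relations determine \<open>U\<close> and \<open>N\<close> on polynomials, and
  explicit differential (\<open>\<Delta> = 0\<close>) or shift (\<open>\<Delta> \<noteq> 0\<close>) operators satisfy them.

  This is an identity for the formal polynomials \<open>P\<^sub>n\<close> of the three-term recurrence with the Meixner
  formulas at all \<open>n\<close>. If \<open>X\<close> has \<open>K\<close> values, then \<open>f\<^sub>n(X) = 0\<close> for \<open>n \<ge> K\<close>, so changing the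
  Szego--Jacobi parameters to the Meixner formulas beyond \<open>K\<close> keeps the recurrence valid; hence
  \<open>f\<^sub>n(X) = P\<^sub>n(X)\<close> almost surely for every \<open>n\<close>, and the \<open>P\<^sub>n\<close> span \<open>\<complex>[x]\<close>.
\<close>

section \<open>Meixner polynomials\<close>

text \<open>These formal polynomials do not depend on a measure, so they stay monic of degree n even
  where f_n(X) vanishes. The value \<open>w 0\<close> is never read: the clause for
  \<open>Suc 0\<close> stands in for a term of index -1.\<close>

fun jacobi_poly :: "(nat \<Rightarrow> real) \<Rightarrow> (nat \<Rightarrow> real) \<Rightarrow> nat \<Rightarrow> complex poly" where
  "jacobi_poly a w 0 = 1"
| "jacobi_poly a w (Suc 0) = [:- of_real (a 0), 1:]"
| "jacobi_poly a w (Suc (Suc n)) =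
    [:- of_real (a (Suc n)), 1:] * jacobi_poly a w (Suc n)
      - smult (of_real (w (Suc n))) (jacobi_poly a w n)"

text \<open>The recursive clauses merge into one: at \<open>n = 0\<close> the truncated index
  \<open>n - 1\<close> is 0, but its coefficient \<open>w 0\<close> vanishes.\<close>

lemma jacobi_poly_Suc:
  assumes "w 0 = 0"
  shows "jacobi_poly a w (Suc n) =
    pCons 0 (jacobi_poly a w n) - smult (of_real (a n)) (jacobi_poly a w n)
      - smult (of_real (w n)) (jacobi_poly a w (n - 1))"
  using assms by (cases n) (auto simp: one_pCons)

lemma jacobi_poly_monic:
  "degree (jacobi_poly a w n) \<le> n \<and> coeff (jacobi_poly a w n) n = 1"
proof (induction a w n rule: jacobi_poly.induct)
  case (3 a w n)
  let ?P = "jacobi_poly a w (Suc n)" and ?Q = "jacobi_poly a w n"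
  have "degree (jacobi_poly a w (Suc (Suc n))) \<le> Suc (Suc n)"
    using 3 by (auto intro!: degree_diff_le degree_add_le
        intro: order.trans[OF degree_smult_le])
  moreover have "coeff ?P (Suc (Suc n)) = 0" "coeff ?Q (Suc (Suc n)) = 0"
    using 3 by (auto intro!: coeff_eq_0)
  ultimately show ?case using 3 by auto
qed auto

text \<open>One monic polynomial in each degree spans everything: subtracting
  \<open>lead_coeff f\<close> times the member of the same degree leaves 0 or a polynomial of
  smaller degree.\<close>

lemma jacobi_poly_span [consumes 0, case_names zero add smult jacobi_poly]:
  assumes zero: "Q 0"
    and add: "\<And>f g. Q f \<Longrightarrow> Q g \<Longrightarrow> Q (f + g)"
    and smult: "\<And>c f. Q f \<Longrightarrow> Q (smult c f)"
    and jacobi: "\<And>n. Q (jacobi_poly a w n)"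
  shows "Q f"
proof (induction "degree f" arbitrary: f rule: less_induct)
  case less
  define n where "n = degree f"
  let ?h = "smult (lead_coeff f) (jacobi_poly a w n)"
  define g where "g = f - ?h"
  have f: "f = g + ?h" by (simp add: g_def)
  have "degree g \<le> n"
    unfolding g_def n_def
    by (intro degree_diff_le order.trans[OF degree_smult_le])
       (use jacobi_poly_monic in auto)
  moreover have "coeff g n = 0"
    using jacobi_poly_monic[of a w n] by (simp add: g_def n_def)
  ultimately have "g = 0 \<or> degree g < degree f"
    by (metis leading_coeff_0_iff n_def order_le_less)
  hence "Q g" using less zero by auto
  thus ?case using add[OF _ smult[OF jacobi]] f by metis
qed

section \<open>Meixner parameters and the commutation relations\<close>

definition meixner_a :: "real \<Rightarrow> real \<Rightarrow> nat \<Rightarrow> real" where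
  "meixner_a \<alpha> \<alpha>\<^sub>0 n = \<alpha> * real n + \<alpha>\<^sub>0"

definition meixner_w :: "real \<Rightarrow> real \<Rightarrow> nat \<Rightarrow> real" where
  "meixner_w \<beta> t n = \<beta> * (real n)\<^sup>2 + (t - \<beta>) * real n"

abbreviation meixner_poly :: "real \<Rightarrow> real \<Rightarrow> real \<Rightarrow> real \<Rightarrow> nat \<Rightarrow> complex poly" where
  "meixner_poly \<alpha> \<alpha>\<^sub>0 \<beta> t \<equiv> jacobi_poly (meixner_a \<alpha> \<alpha>\<^sub>0) (meixner_w \<beta> t)"

text \<open>\<open>R\<close> plays the role of \<open>U\<close>, and \<open>S\<close> that of the number operator.\<close>

lemma meixner_operator_jacobi_poly:
  fixes R S :: "complex poly \<Rightarrow> complex poly" and \<alpha> \<alpha>\<^sub>0 \<beta> t :: real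
  assumes R_diff: "\<And>f g. R (f - g) = R f - R g" and R_smult: "\<And>c f. R (smult c f) = smult c (R f)"
    and S_diff: "\<And>f g. S (f - g) = S f - S g" and S_smult: "\<And>c f. S (smult c f) = smult c (S f)"
    and R_1: "R 1 = [:of_real (\<alpha>\<^sub>0 / 2):]" and S_1: "S 1 = 0"
    and R_X: "\<And>f. R (pCons 0 f) = pCons 0 (R f)
      + smult (1/2) ([:of_real (2 * t - \<alpha> * \<alpha>\<^sub>0), of_real \<alpha>:] * f)
      - smult (of_real ((\<alpha>\<^sup>2 - 4 * \<beta>) / 2)) (S f)"
    and S_X: "\<And>f. S (pCons 0 f) = pCons 0 (S f) + pCons 0 f - smult 2 (R f)"
  defines "a \<equiv> meixner_a \<alpha> \<alpha>\<^sub>0" and "w \<equiv> meixner_w \<beta> t"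
  defines "P \<equiv> jacobi_poly a w"
  shows "R (P n) = smult (of_real (w n)) (P (n - 1)) + smult (of_real (a n / 2)) (P n)
    \<and> S (P n) = smult (of_nat n) (P n)"
\<comment> \<open>For \<open>n = Suc m\<close> the recurrence involves \<open>P m\<close> and
  \<open>P (m - 1)\<close>, so the hypothesis is needed at both indices.\<close>
proof (induction n rule: less_induct)
  case (less n)
  have w0: "w 0 = 0" by (simp add: w_def meixner_w_def)
  note rec = jacobi_poly_Suc[of w a, OF w0, folded P_def]
  show ?case
  proof (cases n)
    case 0
    then show ?thesis by (simp add: P_def R_1 S_1 w0 a_def meixner_a_def)
  next
    case (Suc m)
    have Rm: "R (P m) = smult (of_real (w m)) (P (m - 1)) + smult (of_real (a m / 2)) (P m)"
      and Sm: "S (P m) = smult (of_nat m) (P m)"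
      using less[of m] Suc by auto
    have Rk: "R (P (m - 1)) = smult (of_real (w (m - 1))) (P (m - 1 - 1))
        + smult (of_real (a (m - 1) / 2)) (P (m - 1))"
      and Sk: "S (P (m - 1)) = smult (of_nat (m - 1)) (P (m - 1))"
      using less[of "m - 1"] Suc by auto
    define \<mu> where "\<mu> = (of_nat m :: complex)"
    have Pn: "P n = pCons 0 (P m) - smult (of_real (a m)) (P m) - smult (of_real (w m)) (P (m - 1))"
      using rec[of m] Suc by simp
    have "poly (R (P n)) x
        = poly (smult (of_real (w n)) (P (n - 1)) + smult (of_real (a n / 2)) (P n)) x
      \<and> poly (S (P n)) x = poly (smult (of_nat n) (P n)) x" for x
    proof -
      \<comment> \<open>The weights are built into \<open>u\<close> and \<open>v\<close>, so that
        terms with a truncated index vanish on their own: \<open>w 0 = 0\<close>.\<close>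
      define p u v where "p = poly (P m) x" and "u = of_real (w m) * poly (P (m - 1)) x"
        and "v = of_real (w m) * of_real (w (m - 1)) * poly (P (m - 1 - 1)) x"
      have a: "complex_of_real (a m) = of_real \<alpha> * \<mu> + of_real \<alpha>\<^sub>0"
          "complex_of_real (a n) = of_real \<alpha> * (\<mu> + 1) + of_real \<alpha>\<^sub>0"
        and w: "complex_of_real (w n)
          = of_real \<beta> * (\<mu> + 1)\<^sup>2 + (of_real t - of_real \<beta>) * (\<mu> + 1)"
          "complex_of_real (w m) = of_real \<beta> * \<mu>\<^sup>2 + (of_real t - of_real \<beta>) * \<mu>"
        using Suc by (simp_all add: a_def w_def meixner_a_def meixner_w_def \<mu>_def algebra_simps)
      \<comment> \<open>The recurrence for \<open>P m\<close>, solved for x times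
        \<open>P (m - 1)\<close> and multiplied by \<open>w m\<close>; here a_(m-1) = a_m -
        \<alpha>.\<close>
      have xu: "x * u = of_real (w m) * p + (of_real (a m) - of_real \<alpha>) * u + v"
      proof (cases m)
        case (Suc k)
        have "of_real (a m) - of_real \<alpha> = complex_of_real (a (m - 1))"
          using Suc by (simp add: a_def meixner_a_def algebra_simps)
        with arg_cong[OF rec[of k], of "\<lambda>p. of_real (w m) * poly p x"] Suc show ?thesis
          by (simp add: p_def u_def v_def algebra_simps)
      qed (simp add: u_def v_def w0)
      \<comment> \<open>Truncated subtraction makes \<open>m - 1\<close> off by one at
        \<open>m = 0\<close>; the factor \<open>w m\<close> is 0 there, so both identities hold for
        every \<open>m\<close>.\<close>
      have ak: "of_real (w m) * (of_real (a (m - 1)) * y)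
          = (of_real (a m) - of_real \<alpha>) * (of_real (w m) * y)"
        and nk: "of_real (w m) * (of_nat (m - 1) * y) = (\<mu> - 1) * (of_real (w m) * y)" for y :: complex
        by (cases m; simp add: w0 \<mu>_def a_def meixner_a_def algebra_simps)+
      have hP: "poly (P n) x = x * p - of_real (a m) * p - u"
        by (simp add: Pn p_def u_def)
      have hS: "poly (S (P n)) x = x * (\<mu> * p) + x * p - 2 * (u + of_real (a m) / 2 * p)
          - of_real (a m) * \<mu> * p - (\<mu> - 1) * u"
        using nk[of "poly (P (m - 1)) x"]
        unfolding Pn S_diff S_smult S_X Sm Sk Rm
        by (simp add: p_def u_def \<mu>_def[symmetric] algebra_simps)
      have hR: "poly (R (P n)) x = x * (u + of_real (a m) / 2 * p)
          + (of_real (2 * t - \<alpha> * \<alpha>\<^sub>0) + of_real \<alpha> * x) / 2 * p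
          - of_real ((\<alpha>\<^sup>2 - 4 * \<beta>) / 2) * \<mu> * p
          - of_real (a m) * (u + of_real (a m) / 2 * p)
          - (v + (of_real (a m) - of_real \<alpha>) / 2 * u)"
        using ak[of "poly (P (m - 1)) x"]
        unfolding Pn R_diff R_smult R_X Rm Rk Sm
        by (simp add: p_def u_def v_def \<mu>_def[symmetric] field_simps) algebra
      \<comment> \<open>Substituting this removes the third polynomial and leaves identities in
        \<open>x\<close>, \<open>p\<close> and \<open>u\<close> alone.\<close>
      have v: "v = x * u - of_real (w m) * p - (of_real (a m) - of_real \<alpha>) * u"
        using xu by (simp add: algebra_simps)
      have "poly (S (P n)) x = (\<mu> + 1) * poly (P n) x"
        unfolding hS hP by (simp add: algebra_simps)
      \<comment> \<open>The terms in x p and in u match because a_n = a_m + \<alpha>; those in p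
        reduce to w_n - w_m = t + 2 \<beta> \<mu>, where the quadratic form of the parameters
        enters.\<close>
      moreover have "poly (R (P n)) x = of_real (w n) * p + of_real (a n) / 2 * poly (P n) x"
        unfolding hR hP v a w by (simp add: field_simps power2_eq_square)
      ultimately show ?thesis
        using Suc by (simp add: p_def \<mu>_def add.commute)
    qed
    then show ?thesis by (simp add: poly_eq_poly_eq_iff[symmetric] fun_eq_iff)
  qed
qed

section \<open>The explicit differential and shift operators\<close>

definition meixner_diff_op :: "real \<Rightarrow> real \<Rightarrow> real \<Rightarrow> complex poly \<Rightarrow> complex poly" where
  "meixner_diff_op \<alpha> \<alpha>\<^sub>0 \<tau> f =
    smult (of_real (\<alpha>\<^sub>0 / 2)) f + smult (1/2) ([:of_real \<tau>, of_real \<alpha>:] * pderiv f)"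

definition meixner_shift_op ::
    "real \<Rightarrow> real \<Rightarrow> real \<Rightarrow> complex \<Rightarrow> complex poly \<Rightarrow> complex poly" where
  "meixner_shift_op \<alpha> \<alpha>\<^sub>0 \<tau> \<delta> f =
    smult (of_real (\<alpha>\<^sub>0 / 2)) f
    - smult (1/4) ([:- of_real \<alpha>\<^sub>0, 1:] * (translate \<delta> f + translate (- \<delta>) f - smult 2 f))
    + smult (1 / (4 * \<delta>)) ([:of_real \<tau>, of_real \<alpha>:] * (translate \<delta> f - translate (- \<delta>) f))"

lemma poly_translate [simp]: "poly (translate c f) x = poly f (x + c)"
  by (simp add: translate_def poly_pcompose add.commute)

text \<open>For \<Delta> = 0 the relation for [R, X] loses its \<open>S\<close> term and is just the
  product rule [D, X] = I. An \<open>S\<close> must still be exhibited for the other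
  relation.\<close>

lemma meixner_diff_op_jacobi_poly:
  fixes \<alpha> \<alpha>\<^sub>0 \<beta> t :: real
  assumes "\<alpha>\<^sup>2 - 4 * \<beta> = 0"
  defines "P \<equiv> meixner_poly \<alpha> \<alpha>\<^sub>0 \<beta> t"
  shows "meixner_diff_op \<alpha> \<alpha>\<^sub>0 (2 * t - \<alpha> * \<alpha>\<^sub>0) (P n)
    = smult (of_real (meixner_w \<beta> t n)) (P (n - 1))
      + smult (of_real (meixner_a \<alpha> \<alpha>\<^sub>0 n / 2)) (P n)"
proof -
  define R where "R = meixner_diff_op \<alpha> \<alpha>\<^sub>0 (2 * t - \<alpha> * \<alpha>\<^sub>0)"
  \<comment> \<open>The requirement is [S, X] = X - 2R = (X - \<open>\<alpha>\<^sub>0\<close>) I -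
    (\<alpha> X + \<tau>) D and S 1 = 0. Since [D, X] = I and [D^2, X] = 2D, the coefficients of D
    and D^2 can be read off.\<close>
  define S :: "complex poly \<Rightarrow> complex poly" where
    "S f = [:- of_real \<alpha>\<^sub>0, 1:] * pderiv f
      - smult (1/2) ([:of_real (2 * t - \<alpha> * \<alpha>\<^sub>0), of_real \<alpha>:] * pderiv (pderiv f))" for f
  note defs = R_def S_def meixner_diff_op_def
  note pd = pderiv_diff pderiv_smult pderiv_pCons pderiv_add
  have "R (f - g) = R f - R g" "R (smult c f) = smult c (R f)"
    "S (f - g) = S f - S g" "S (smult c f) = smult c (S f)" "R 1 = [:of_real (\<alpha>\<^sub>0 / 2):]" "S 1 = 0"
    "R (pCons 0 f) = pCons 0 (R f)
      + smult (1/2) ([:of_real (2 * t - \<alpha> * \<alpha>\<^sub>0), of_real \<alpha>:] * f)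
      - smult (of_real ((\<alpha>\<^sup>2 - 4 * \<beta>) / 2)) (S f)"
    "S (pCons 0 f) = pCons 0 (S f) + pCons 0 f - smult 2 (R f)" for c f g
    unfolding defs assms(1)
    by (rule poly_ext; simp add: pd field_simps)+
  from meixner_operator_jacobi_poly[of R S \<alpha>\<^sub>0 t \<alpha> \<beta>, OF this] show ?thesis
    by (simp add: R_def P_def)
qed

text \<open>Everything follows from [T_c, X] = c T_c: commuting with X exchanges sums and
  differences of the two translations, each time with a factor \<delta>, and \<delta>^2 =
  \<Delta>.\<close>

lemma meixner_shift_op_jacobi_poly:
  fixes \<alpha> \<alpha>\<^sub>0 \<beta> t :: real and \<delta> :: complex
  assumes "\<alpha>\<^sup>2 - 4 * \<beta> \<noteq> 0" and \<delta>: "\<delta>\<^sup>2 = of_real (\<alpha>\<^sup>2 - 4 * \<beta>)"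
  defines "P \<equiv> meixner_poly \<alpha> \<alpha>\<^sub>0 \<beta> t"
  shows "meixner_shift_op \<alpha> \<alpha>\<^sub>0 (2 * t - \<alpha> * \<alpha>\<^sub>0) \<delta> (P n)
    = smult (of_real (meixner_w \<beta> t n)) (P (n - 1))
      + smult (of_real (meixner_a \<alpha> \<alpha>\<^sub>0 n / 2)) (P n)"
proof -
  define R where "R = meixner_shift_op \<alpha> \<alpha>\<^sub>0 (2 * t - \<alpha> * \<alpha>\<^sub>0) \<delta>"
  \<comment> \<open>As \<Delta> is nonzero, the relation for [R, X] can be solved for
    \<open>S\<close>; this is the result.\<close>
  define S :: "complex poly \<Rightarrow> complex poly" where
    "S f = smult (1 / (2 * \<delta>)) ([:- of_real \<alpha>\<^sub>0, 1:] * (translate \<delta> f - translate (- \<delta>) f))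
      - smult (1 / (2 * \<delta>\<^sup>2)) ([:of_real (2 * t - \<alpha> * \<alpha>\<^sub>0), of_real \<alpha>:]
          * (translate \<delta> f + translate (- \<delta>) f - smult 2 f))" for f
  have \<delta>0: "\<delta> \<noteq> 0" using assms(1) \<delta> by (metis of_real_eq_0_iff zero_power2)
  have half: "complex_of_real ((\<alpha>\<^sup>2 - 4 * \<beta>) / 2) = \<delta>\<^sup>2 / 2" using \<delta> by simp
  note defs = R_def S_def meixner_shift_op_def
  have "R (f - g) = R f - R g" "R (smult c f) = smult c (R f)"
    "S (f - g) = S f - S g" "S (smult c f) = smult c (S f)" for c f g
    unfolding defs by (rule poly_ext; simp add: algebra_simps)+
  moreover have "R 1 = [:of_real (\<alpha>\<^sub>0 / 2):]" "S 1 = 0"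
    unfolding defs by (rule poly_ext; simp)+
  moreover have "R (pCons 0 f) = pCons 0 (R f)
      + smult (1/2) ([:of_real (2 * t - \<alpha> * \<alpha>\<^sub>0), of_real \<alpha>:] * f)
      - smult (of_real ((\<alpha>\<^sup>2 - 4 * \<beta>) / 2)) (S f)" for f
    unfolding defs half using \<delta>0
    by (intro poly_ext) (simp add: field_simps power2_eq_square)
  moreover have "S (pCons 0 f) = pCons 0 (S f) + pCons 0 f - smult 2 (R f)" for f
    unfolding defs using \<delta>0
    by (intro poly_ext) (simp add: field_simps power2_eq_square)
  ultimately show ?thesis
    using meixner_operator_jacobi_poly[of R S \<alpha>\<^sub>0 t \<alpha> \<beta>] by (simp add: R_def P_def)
qed

section \<open>Orthogonal polynomials of a random variable\<close>

lemma ae_eq_sym: "ae_eq M g h \<Longrightarrow> ae_eq M h g"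
  unfolding ae_eq_def by (auto elim: AE_mp)

lemma poly_rv_simps [simp]:
  "poly_rv X 0 \<omega> = 0" "poly_rv X 1 \<omega> = 1"
  "poly_rv X (p + q) \<omega> = poly_rv X p \<omega> + poly_rv X q \<omega>"
  "poly_rv X (p - q) \<omega> = poly_rv X p \<omega> - poly_rv X q \<omega>"
  "poly_rv X (p * q) \<omega> = poly_rv X p \<omega> * poly_rv X q \<omega>"
  "poly_rv X (smult c p) \<omega> = c * poly_rv X p \<omega>"
  "poly_rv X (pCons c p) \<omega> = c + of_real (X \<omega>) * poly_rv X p \<omega>"
  by (simp_all add: poly_rv_def)

text \<open>\<open>X\<close> is real-valued, so conjugation reaches only the coefficients.\<close>

lemma cnj_poly_rv: "cnj (poly_rv X p \<omega>) = poly_rv X (map_poly cnj p) \<omega>"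
  by (induction p) (auto simp: map_poly_pCons)

lemma degree_diff_less_lead_coeff_eq:
  fixes p q :: "'b::comm_ring_1 poly"
  assumes "degree p = degree q" "lead_coeff p = lead_coeff q" "p \<noteq> q"
  shows "degree (p - q) < degree p"
proof -
  have "degree (p - q) \<le> degree p" using assms by (intro degree_diff_le) auto
  moreover have "degree (p - q) \<noteq> degree p"
    using assms by (metis coeff_diff diff_self leading_coeff_0_iff right_minus_eq)
  ultimately show ?thesis by simp
qed

locale rv_all_moments = prob_space M for M :: "'a measure" +
  fixes X :: "'a \<Rightarrow> real"
  assumes X_meas [measurable]: "X \<in> borel_measurable M"
    and X_moments: "integrable M (\<lambda>\<omega>. X \<omega> ^ n)"
begin

lemma integrable_poly_rv [intro, simp]: "integrable M (poly_rv X p)"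
proof -
  have "integrable M (\<lambda>\<omega>. \<Sum>i\<le>degree p. coeff p i * complex_of_real (X \<omega> ^ i))"
    by (intro Bochner_Integration.integrable_sum integrable_mult_right integrable_of_real X_moments)
  thus ?thesis by (simp add: poly_rv_def poly_altdef)
qed

lemma measurable_poly_rv [measurable]: "poly_rv X p \<in> borel_measurable M"
  by (rule borel_measurable_integrable) simp

text \<open>The integrand is again a polynomial in \<open>X\<close>, so the integrability behind
  linearity of inner products comes from \<open>integrable_poly_rv\<close>.\<close>

lemma inner_L2_poly_rv:
  "inner_L2 M (poly_rv X p) (poly_rv X q) = (LINT \<omega>|M. poly_rv X (p * map_poly cnj q) \<omega>)"
  by (simp add: inner_L2_def cnj_poly_rv)

section \<open>The orthogonal complements G_k and their monic elements\<close>

lemma poly_rv_in_G_space_iff: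
  "poly_rv X p \<in> G_space M X k \<longleftrightarrow> poly_rv X p \<in> F_upto X k \<and>
    (\<forall>q. q = 0 \<or> int (degree q) \<le> k - 1 \<longrightarrow> inner_L2 M (poly_rv X p) (poly_rv X q) = 0)"
  by (auto simp: G_space_def F_upto_def)

lemma poly_rv_smult_eq: "poly_rv X (smult c p) = (\<lambda>\<omega>. c * poly_rv X p \<omega>)"
  by auto

lemma G_space_smult:
  assumes "poly_rv X p \<in> G_space M X k"
  shows "poly_rv X (smult c p) \<in> G_space M X k"
proof -
  \<comment> \<open>Membership in \<open>F_upto\<close> concerns the random variable:
    \<open>p\<close> itself may have larger degree, so a representative of low degree is
    chosen.\<close>
  obtain p' where p': "poly_rv X p = poly_rv X p'" "p' = 0 \<or> int (degree p') \<le> k"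
    using assms unfolding G_space_def F_upto_def by auto
  have "poly_rv X (smult c p) = poly_rv X (smult c p')"
    using p'(1) by (simp add: poly_rv_smult_eq)
  hence "poly_rv X (smult c p) \<in> F_upto X k"
    using p'(2) degree_smult_le[of c p'] unfolding F_upto_def by fastforce
  thus ?thesis using assms by (auto simp: poly_rv_in_G_space_iff inner_L2_poly_rv)
qed

lemma G_space_zero: "poly_rv X 0 \<in> G_space M X k"
  by (auto simp: poly_rv_in_G_space_iff inner_L2_poly_rv F_upto_def)

lemma G_space_diff:
  assumes "poly_rv X p \<in> G_space M X k" "poly_rv X q \<in> G_space M X k"
    and "poly_rv X (p - q) \<in> F_upto X k"
  shows "poly_rv X (p - q) \<in> G_space M X k"
  using assms by (auto simp: poly_rv_in_G_space_iff inner_L2_poly_rv ring_distribs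
      simp del: poly_rv_simps(5) minus_mult_left)

text \<open>Being orthogonal to \<open>h\<close>, the element \<open>g\<close> is orthogonal to
  itself, so its norm is 0. Most vanishing arguments below reduce to this.\<close>

lemma ae_eq_zero_if_G_space:
  assumes g: "g \<in> G_space M X k" and h: "h \<in> F_upto X (k - 1)" and ae: "ae_eq M g h"
  shows "ae_eq M g (\<lambda>_. 0)"
proof -
  obtain p q where p: "g = poly_rv X p" and q: "h = poly_rv X q"
    using g h by (auto simp: G_space_def F_upto_def)
  have "0 = inner_L2 M g h" using g h by (simp add: G_space_def)
  also have "\<dots> = inner_L2 M g g"
    unfolding inner_L2_def
  proof (rule Bochner_Integration.integral_cong_AE)
    show "AE \<omega> in M. g \<omega> * cnj (h \<omega>) = g \<omega> * cnj (g \<omega>)"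
      using ae unfolding ae_eq_def by eventually_elim simp
  qed (simp_all add: p q cnj_poly_rv)
  also have "\<dots> = (LINT \<omega>|M. complex_of_real ((cmod (g \<omega>))\<^sup>2))"
    unfolding inner_L2_def by (simp only: complex_norm_square)
  finally have 0: "(LINT \<omega>|M. (cmod (g \<omega>))\<^sup>2) = 0"
    by (simp del: of_real_power)
  have "integrable M (\<lambda>\<omega>. Re (poly_rv X (p * map_poly cnj p) \<omega>))"
    by (rule integrable_Re[OF integrable_poly_rv])
  hence "integrable M (\<lambda>\<omega>. (cmod (g \<omega>))\<^sup>2)"
    by (simp add: p flip: cnj_poly_rv complex_norm_square)
  with 0 have "AE \<omega> in M. (cmod (g \<omega>))\<^sup>2 = 0"
    by (subst (asm) integral_nonneg_eq_0_iff_AE) auto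
  thus ?thesis by (simp add: ae_eq_def)
qed

text \<open>Existence: a nonzero element of G_k has a representative of degree exactly
  \<open>k\<close>, which can be normalised. Uniqueness holds even for polynomials: a nonzero
  difference of two candidates would be a polynomial of degree below \<open>k\<close> vanishing at
  X, and reduction by it would lower the degree of every representative.\<close>

lemma ex1_monic_orth_poly:
  assumes "\<not> (\<forall>g \<in> G_space M X k. ae_eq M g (\<lambda>_. 0))"
  shows "\<exists>!p. lead_coeff p = 1 \<and> int (degree p) = k \<and> poly_rv X p \<in> G_space M X k"
proof -
  from assms obtain g where g: "g \<in> G_space M X k" "\<not> ae_eq M g (\<lambda>_. 0)" by blast
  then obtain p0 where p0: "g = poly_rv X p0" "p0 = 0 \<or> int (degree p0) \<le> k"
    by (auto simp: G_space_def F_upto_def)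
  \<comment> \<open>A nonzero element of G_k cannot be represented in degree below \<open>k\<close>;
    this gives the exact degree of \<open>p0\<close> and the final contradiction.\<close>
  have not_lower: "\<not> (q = 0 \<or> int (degree q) \<le> k - 1)" if "ae_eq M g (poly_rv X q)" for q
    using ae_eq_zero_if_G_space[OF g(1) _ that] g(2) by (auto simp: F_upto_def)
  have "p0 \<noteq> 0" "int (degree p0) = k"
    using p0 not_lower[of p0] by (auto simp: ae_eq_def)
  show ?thesis
  proof (rule ex_ex1I)
    show "\<exists>p. lead_coeff p = 1 \<and> int (degree p) = k \<and> poly_rv X p \<in> G_space M X k"
      using \<open>p0 \<noteq> 0\<close> \<open>int (degree p0) = k\<close> G_space_smult[of p0 k "1 / lead_coeff p0"] g(1)
      by (intro exI[of _ "smult (1 / lead_coeff p0) p0"]) (auto simp: p0(1))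
  next
    fix p q
    assume p: "lead_coeff p = 1 \<and> int (degree p) = k \<and> poly_rv X p \<in> G_space M X k"
      and q: "lead_coeff q = 1 \<and> int (degree q) = k \<and> poly_rv X q \<in> G_space M X k"
    show "p = q"
    proof (rule ccontr)
      assume "p \<noteq> q"
      define d where "d = p - q"
      have d: "d \<noteq> 0" "int (degree d) < k"
        using degree_diff_less_lead_coeff_eq[of p q] p q \<open>p \<noteq> q\<close> by (auto simp: d_def)
      have "poly_rv X d \<in> F_upto X (k - 1)" "poly_rv X d \<in> F_upto X k"
        using d by (auto simp: F_upto_def)
      hence d0: "ae_eq M (poly_rv X d) (\<lambda>_. 0)"
        using G_space_diff[of p k q] p q
        by (intro ae_eq_zero_if_G_space[of _ k "poly_rv X d"]) (auto simp: d_def ae_eq_def)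
      \<comment> \<open>A multiple of \<open>d\<close>, hence zero at X almost surely, with the
        degree and leading coefficient of \<open>p0\<close>: subtracting it keeps the random
        variable and lowers the degree.\<close>
      define h where "h = smult (lead_coeff p0 / lead_coeff d) (monom 1 (degree p0 - degree d) * d)"
      have "degree h = degree p0" "lead_coeff h = lead_coeff p0"
        using d \<open>p0 \<noteq> 0\<close> \<open>int (degree p0) = k\<close>
        by (auto simp: h_def degree_mult_eq degree_monom_eq coeff_monom_mult monom_eq_0_iff)
      hence "p0 - h = 0 \<or> int (degree (p0 - h)) \<le> k - 1"
        using degree_diff_less_lead_coeff_eq[of p0 h] \<open>int (degree p0) = k\<close> by fastforce
      moreover have "ae_eq M g (poly_rv X (p0 - h))"
        using d0 unfolding ae_eq_def by eventually_elim (simp add: p0(1) h_def)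
      ultimately show False using not_lower by blast
    qed
  qed
qed

section \<open>The orthogonal polynomials f_n and their parameters\<close>

lemma orth_poly_cases:
  obtains "\<forall>g \<in> G_space M X k. ae_eq M g (\<lambda>_. 0)" "orth_poly M X k = 0"
  | "lead_coeff (orth_poly M X k) = 1" "int (degree (orth_poly M X k)) = k"
    "orth_rv M X k \<in> G_space M X k"
proof (cases "\<forall>g \<in> G_space M X k. ae_eq M g (\<lambda>_. 0)")
  case False
  from theI'[OF ex1_monic_orth_poly[OF False]] False show ?thesis
    by (intro that(2)) (auto simp: orth_poly_def orth_rv_def)
qed (use that(1) in \<open>auto simp: orth_poly_def\<close>)

lemma orth_rv_in_G_space: "orth_rv M X k \<in> G_space M X k"
  by (cases rule: orth_poly_cases[of k]) (auto simp: orth_rv_def G_space_zero)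

text \<open>No degree is -1, so only the degenerate alternative remains.\<close>

lemma orth_rv_minus_1: "orth_rv M X (- 1) = (\<lambda>_. 0)"
  by (cases rule: orth_poly_cases[of "-1"]) (auto simp: orth_rv_def)

text \<open>The constant 1 lies in G_0 and is not almost surely 0 on a probability space, which
  excludes the degenerate alternative.\<close>

lemma orth_rv_0: "orth_rv M X 0 = (\<lambda>_. 1)"
proof (cases rule: orth_poly_cases[of 0])
  case 1
  have "poly_rv X 1 \<in> G_space M X 0"
    by (auto simp: poly_rv_in_G_space_iff inner_L2_poly_rv F_upto_def intro: exI[of _ 1])
  with 1 show ?thesis by (auto simp: ae_eq_def)
next
  case 2
  hence "orth_poly M X 0 = 1"
    by (metis degree_0_id lead_coeff_1 of_nat_eq_0_iff degree_eq_zeroE lead_coeff_pCons(2) one_pCons)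
  thus ?thesis by (auto simp: orth_rv_def)
qed

text \<open>Subtracting the recurrences gives (a_n - a'_n) f_n = (w'_n - w_n) f_(n-1), with the left
  side in G_n and the right side in F_(n-1); so both vanish. The factors f_n and f_(n-1) stay in the
  statement because they may be 0.\<close>

lemma szego_jacobi_unique:
  assumes "szego_jacobi M X a w" "szego_jacobi M X a' w'"
  shows "ae_eq M (\<lambda>\<omega>. of_real (a n) * orth_rv M X (int n) \<omega>)
      (\<lambda>\<omega>. of_real (a' n) * orth_rv M X (int n) \<omega>)"
    and "ae_eq M (\<lambda>\<omega>. of_real (w n) * orth_rv M X (int n - 1) \<omega>)
      (\<lambda>\<omega>. of_real (w' n) * orth_rv M X (int n - 1) \<omega>)"
proof -
  let ?p = "smult (of_real (a n - a' n)) (orth_poly M X (int n))"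
  let ?q = "smult (of_real (w' n - w n)) (orth_poly M X (int n - 1))"
  have *: "ae_eq M (poly_rv X ?p) (poly_rv X ?q)"
    using assms[unfolded szego_jacobi_def, rule_format, of n]
    unfolding ae_eq_def by eventually_elim (simp add: orth_rv_def algebra_simps)
  have "poly_rv X ?p \<in> G_space M X (int n)" "poly_rv X ?q \<in> F_upto X (int n - 1)"
    using G_space_smult[OF orth_rv_in_G_space[unfolded orth_rv_def]] by (auto simp: G_space_def)
  from ae_eq_zero_if_G_space[OF this *] have 0: "ae_eq M (poly_rv X ?p) (\<lambda>_. 0)" .
  thus "ae_eq M (\<lambda>\<omega>. of_real (a n) * orth_rv M X (int n) \<omega>)
      (\<lambda>\<omega>. of_real (a' n) * orth_rv M X (int n) \<omega>)"
    unfolding ae_eq_def by eventually_elim (simp add: orth_rv_def algebra_simps)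
  show "ae_eq M (\<lambda>\<omega>. of_real (w n) * orth_rv M X (int n - 1) \<omega>)
      (\<lambda>\<omega>. of_real (w' n) * orth_rv M X (int n - 1) \<omega>)"
    using * 0 unfolding ae_eq_def by eventually_elim (auto simp: orth_rv_def left_diff_distrib)
qed

text \<open>The monic polynomial with the \<open>K\<close> values as roots vanishes at X almost
  surely, so f_n(X) equals a remainder modulo it, of degree below \<open>K\<close>, and thus lies in
  F_(n-1) as well as in G_n.\<close>

lemma orth_rv_eq_0_if_takes_exactly:
  assumes "takes_exactly M X K" "K \<le> n"
  shows "ae_eq M (orth_rv M X (int n)) (\<lambda>_. 0)"
proof -
  obtain S where S: "finite S" "card S = K" "AE \<omega> in M. X \<omega> \<in> S"
    using assms(1) by (auto simp: takes_exactly_def)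
  have "S \<noteq> {}" using S(3) by auto
  hence "K > 0" using S by auto
  obtain p where p: "orth_rv M X (int n) = poly_rv X p"
    by (simp add: orth_rv_def)
  define \<pi> where "\<pi> = (\<Prod>s\<in>S. [:- complex_of_real s, 1:])"
  have deg: "degree \<pi> = K" using S by (simp add: \<pi>_def degree_prod_eq_sum_degree)
  have "\<pi> \<noteq> 0" using S by (simp add: \<pi>_def)
  have "p mod \<pi> = 0 \<or> int (degree (p mod \<pi>)) \<le> int n - 1"
    using degree_mod_less[OF \<open>\<pi> \<noteq> 0\<close>, of p] deg assms(2) by auto
  hence "poly_rv X (p mod \<pi>) \<in> F_upto X (int n - 1)" by (auto simp: F_upto_def)
  moreover have "ae_eq M (poly_rv X p) (poly_rv X (p mod \<pi>))"
    unfolding ae_eq_def using S(3)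
  proof eventually_elim
    case (elim \<omega>)
    hence "poly_rv X \<pi> \<omega> = 0" using S(1)
      by (auto simp: poly_rv_def \<pi>_def poly_prod)
    hence "poly_rv X (\<pi> * (p div \<pi>) + p mod \<pi>) \<omega> = poly_rv X (p mod \<pi>) \<omega>"
      unfolding poly_rv_simps by simp
    thus ?case unfolding mult_div_mod_eq .
  qed
  ultimately show ?thesis
    using ae_eq_zero_if_G_space orth_rv_in_G_space[of "int n"] p by simp
qed

text \<open>Parameters that the definition leaves open multiply random variables that vanish almost
  surely, so they can be overwritten by the formulas.\<close>

lemma classical_meixner_szego_jacobi:
  assumes "classical_meixner M X \<alpha> \<alpha>\<^sub>0 \<beta> t"
  shows "szego_jacobi M X (meixner_a \<alpha> \<alpha>\<^sub>0) (meixner_w \<beta> t)"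
proof -
  obtain a w where sj: "szego_jacobi M X a w"
    and fin: "\<And>K. takes_exactly M X K \<Longrightarrow>
      (\<forall>n<K. a n = meixner_a \<alpha> \<alpha>\<^sub>0 n) \<and> (\<forall>n\<in>{1..K}. w n = meixner_w \<beta> t n)"
    and inf: "\<nexists>K. takes_exactly M X K \<Longrightarrow>
      (\<forall>n. a n = meixner_a \<alpha> \<alpha>\<^sub>0 n) \<and> (\<forall>n\<ge>1. w n = meixner_w \<beta> t n)"
    using assms unfolding classical_meixner_def meixner_a_def meixner_w_def by blast
  have a_eq: "ae_eq M (\<lambda>\<omega>. of_real (a n) * orth_rv M X (int n) \<omega>)
      (\<lambda>\<omega>. of_real (meixner_a \<alpha> \<alpha>\<^sub>0 n) * orth_rv M X (int n) \<omega>)" for n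
  proof (cases "a n = meixner_a \<alpha> \<alpha>\<^sub>0 n")
    case False
    then obtain K where "takes_exactly M X K" "K \<le> n"
      using fin inf by (meson not_le)
    from orth_rv_eq_0_if_takes_exactly[OF this] show ?thesis
      unfolding ae_eq_def by eventually_elim simp
  qed (simp add: ae_eq_def)
  \<comment> \<open>Here the index is shifted: \<open>w n\<close> multiplies f_(n-1), which vanishes
    for n > K, while \<open>w K\<close> is given by the formula. The open value \<open>w 0\<close>
    multiplies f_(-1) = 0.\<close>
  have w_eq: "ae_eq M (\<lambda>\<omega>. of_real (w n) * orth_rv M X (int n - 1) \<omega>)
      (\<lambda>\<omega>. of_real (meixner_w \<beta> t n) * orth_rv M X (int n - 1) \<omega>)" for n
  proof (cases "n = 0 \<or> w n = meixner_w \<beta> t n")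
    case False
    then obtain K where "takes_exactly M X K" "K < n"
      using fin inf by (metis One_nat_def Suc_leI atLeastAtMost_iff not_le not_gr_zero)
    moreover have "int n - 1 = int (n - 1)" using False by simp
    ultimately have "ae_eq M (orth_rv M X (int n - 1)) (\<lambda>_. 0)"
      using orth_rv_eq_0_if_takes_exactly[of K "n - 1"] by simp
    then show ?thesis
      unfolding ae_eq_def by eventually_elim simp
  qed (auto simp add: ae_eq_def orth_rv_minus_1)
  show ?thesis
    unfolding szego_jacobi_def
  proof
    fix n
    show "ae_eq M (\<lambda>\<omega>. of_real (X \<omega>) * orth_rv M X (int n) \<omega>)
      (\<lambda>\<omega>. orth_rv M X (int n + 1) \<omega> + of_real (meixner_a \<alpha> \<alpha>\<^sub>0 n) * orth_rv M X (int n) \<omega>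
        + of_real (meixner_w \<beta> t n) * orth_rv M X (int n - 1) \<omega>)"
      using sj[unfolded szego_jacobi_def, rule_format, of n] a_eq[of n] w_eq[of n]
      unfolding ae_eq_def by eventually_elim simp
  qed
qed

text \<open>Both sides start at 1 and obey the same recurrence. The equality is one of random
  variables: f_n may be the zero polynomial, whereas \<open>jacobi_poly a w n\<close> is
  monic.\<close>

lemma orth_rv_eq_jacobi_poly:
  assumes sj: "szego_jacobi M X a w" and w0: "w 0 = 0"
  shows "ae_eq M (orth_rv M X (int n)) (poly_rv X (jacobi_poly a w n))"
proof (induction n rule: less_induct)
  case (less n)
  show ?case
  proof (cases n)
    case 0
    then show ?thesis by (simp add: ae_eq_def orth_rv_0)
  next
    case (Suc m)
    \<comment> \<open>For \<open>m = 0\<close> the random variables f_(-1) and P_0(X) differ, but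
      the weight \<open>w 0\<close> is 0.\<close>
    have prev: "ae_eq M (\<lambda>\<omega>. of_real (w m) * orth_rv M X (int m - 1) \<omega>)
      (\<lambda>\<omega>. of_real (w m) * poly_rv X (jacobi_poly a w (m - 1)) \<omega>)"
    proof (cases m)
      case (Suc k)
      hence k: "int m - 1 = int k" by simp
      have "ae_eq M (orth_rv M X (int k)) (poly_rv X (jacobi_poly a w k))"
        using less[of k] Suc \<open>n = Suc m\<close> by simp
      thus ?thesis unfolding ae_eq_def k
        by eventually_elim (simp add: Suc)
    qed (simp add: ae_eq_def w0)
    have m: "int n = int m + 1" using Suc by simp
    have "ae_eq M (orth_rv M X (int m)) (poly_rv X (jacobi_poly a w m))"
      using less[of m] Suc by simp
    with sj[unfolded szego_jacobi_def, rule_format, of m] prev show ?thesis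
      unfolding ae_eq_def m unfolding Suc jacobi_poly_Suc[of w a, OF w0]
      by eventually_elim (simp add: algebra_simps)
  qed
qed

end

section \<open>Operators on polynomial random variables\<close>

lemma poly_rv_in_F_space [simp]: "poly_rv X p \<in> F_space X"
  by (auto simp: F_space_def)

lemma linear_op_on_FD:
  assumes "linear_op_on_F M X T" "g \<in> F_space X"
  shows "T g \<in> F_space X"
    and "h \<in> F_space X \<Longrightarrow> ae_eq M g h \<Longrightarrow> AE \<omega> in M. T g \<omega> = T h \<omega>"
    and "h \<in> F_space X \<Longrightarrow> AE \<omega> in M. T (\<lambda>\<omega>. g \<omega> + h \<omega>) \<omega> = T g \<omega> + T h \<omega>"
    and "AE \<omega> in M. T (\<lambda>\<omega>. c * g \<omega>) \<omega> = c * T g \<omega>"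
  using assms unfolding linear_op_on_F_def ae_eq_def by blast+

lemma linear_op_on_F_add_scaled:
  assumes S: "linear_op_on_F M X S" and T: "linear_op_on_F M X T"
  shows "linear_op_on_F M X (\<lambda>g \<omega>. S g \<omega> + c * T g \<omega>)"
  unfolding linear_op_on_F_def
proof (intro conjI ballI allI impI)
  fix g assume "g \<in> F_space X"
  then obtain p q where "S g = poly_rv X p" "T g = poly_rv X q"
    using linear_op_on_FD(1)[OF S] linear_op_on_FD(1)[OF T] unfolding F_space_def by blast
  hence "(\<lambda>\<omega>. S g \<omega> + c * T g \<omega>) = poly_rv X (p + smult c q)" by auto
  thus "(\<lambda>\<omega>. S g \<omega> + c * T g \<omega>) \<in> F_space X" by simp
next
  fix g h assume gh: "g \<in> F_space X" "h \<in> F_space X"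
  have "AE \<omega> in M. S (\<lambda>\<omega>. g \<omega> + h \<omega>) \<omega> = S g \<omega> + S h \<omega>"
    "AE \<omega> in M. T (\<lambda>\<omega>. g \<omega> + h \<omega>) \<omega> = T g \<omega> + T h \<omega>"
    by (rule linear_op_on_FD(3)[OF S gh] linear_op_on_FD(3)[OF T gh])+
  thus "ae_eq M (\<lambda>\<omega>. S (\<lambda>\<omega>. g \<omega> + h \<omega>) \<omega> + c * T (\<lambda>\<omega>. g \<omega> + h \<omega>) \<omega>)
      (\<lambda>\<omega>. (S g \<omega> + c * T g \<omega>) + (S h \<omega> + c * T h \<omega>))"
    unfolding ae_eq_def by eventually_elim (simp add: algebra_simps)
  assume "ae_eq M g h"
  hence "AE \<omega> in M. S g \<omega> = S h \<omega>" "AE \<omega> in M. T g \<omega> = T h \<omega>"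
    using linear_op_on_FD(2)[OF S gh] linear_op_on_FD(2)[OF T gh] by simp_all
  thus "ae_eq M (\<lambda>\<omega>. S g \<omega> + c * T g \<omega>) (\<lambda>\<omega>. S h \<omega> + c * T h \<omega>)"
    unfolding ae_eq_def by eventually_elim simp
next
  fix d g assume g: "g \<in> F_space X"
  have "AE \<omega> in M. S (\<lambda>\<omega>. d * g \<omega>) \<omega> = d * S g \<omega>" "AE \<omega> in M. T (\<lambda>\<omega>. d * g \<omega>) \<omega> = d * T g \<omega>"
    by (rule linear_op_on_FD(4)[OF S g] linear_op_on_FD(4)[OF T g])+
  thus "ae_eq M (\<lambda>\<omega>. S (\<lambda>\<omega>. d * g \<omega>) \<omega> + c * T (\<lambda>\<omega>. d * g \<omega>) \<omega>)
      (\<lambda>\<omega>. d * (S g \<omega> + c * T g \<omega>))"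
    unfolding ae_eq_def by eventually_elim (simp add: algebra_simps)
qed

text \<open>\<open>T\<close> acts on random variables and \<open>R\<close> on polynomials, so
  \<open>R\<close> need not respect almost sure equality; linearity on both sides carries agreement
  on a spanning family over to all polynomials.\<close>

lemma linear_op_on_F_eqI_jacobi_poly:
  assumes T: "linear_op_on_F M X T"
    and R_add: "\<And>f g. R (f + g) = R f + R g" and R_smult: "\<And>c f. R (smult c f) = smult c (R f)"
    and basis: "\<And>n. ae_eq M (T (poly_rv X (jacobi_poly a w n))) (poly_rv X (R (jacobi_poly a w n)))"
  shows "ae_eq M (T (poly_rv X f)) (poly_rv X (R f))"
proof -
  have T_add: "AE \<omega> in M. T (poly_rv X (f + g)) \<omega> = T (poly_rv X f) \<omega> + T (poly_rv X g) \<omega>"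
    and T_smult: "AE \<omega> in M. T (poly_rv X (smult c f)) \<omega> = c * T (poly_rv X f) \<omega>" for f g c
  proof -
    have "poly_rv X (f + g) = (\<lambda>\<omega>. poly_rv X f \<omega> + poly_rv X g \<omega>)"
      "poly_rv X (smult c f) = (\<lambda>\<omega>. c * poly_rv X f \<omega>)" by auto
    then show "AE \<omega> in M. T (poly_rv X (f + g)) \<omega> = T (poly_rv X f) \<omega> + T (poly_rv X g) \<omega>"
      "AE \<omega> in M. T (poly_rv X (smult c f)) \<omega> = c * T (poly_rv X f) \<omega>"
      using linear_op_on_FD(3,4)[OF T poly_rv_in_F_space] by simp_all
  qed
  show ?thesis
  proof (induction f rule: jacobi_poly_span[where a = a and w = w])
    case zero
    \<comment> \<open>Both operators send 0 to 0 by homogeneity with factor 0.\<close>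
    show ?case using T_smult[of 0 0] R_smult[of 0 0] by (simp add: ae_eq_def del: poly_rv_simps(1)) simp
  next
    case (add f g)
    thus ?case using T_add[of f g] unfolding ae_eq_def R_add by eventually_elim simp
  next
    case (smult c f)
    thus ?case using T_smult[of c f] unfolding ae_eq_def R_smult by eventually_elim simp
  qed (rule basis)
qed

context rv_all_moments
begin

text \<open>The operators come with parameters \<open>a\<close>, \<open>w\<close>, while
  \<open>R\<close> is known on the polynomials of the pair \<open>a'\<close>, \<open>w'\<close>;
  \<open>szego_jacobi_unique\<close> makes the pairs interchangeable on the f_n. The second formula
  reflects V = X - U.\<close>

lemma semi_operators_eqI:
  assumes sj: "szego_jacobi M X a w" and sj': "szego_jacobi M X a' w'" and w0: "w' 0 = 0"
    and ap: "creation_op M X ap" and az: "preservation_op M X a az" and am: "annihilation_op M X w am"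
    and R_add: "\<And>f g. R (f + g) = R f + R g" and R_smult: "\<And>c f. R (smult c f) = smult c (R f)"
  defines "P \<equiv> jacobi_poly a' w'"
  assumes R: "\<And>n. R (P n) = smult (of_real (w' n)) (P (n - 1)) + smult (of_real (a' n / 2)) (P n)"
  shows "ae_eq M (semi_annihilation am az (poly_rv X f)) (poly_rv X (R f))"
    and "ae_eq M (semi_creation ap az (poly_rv X f)) (poly_rv X (pCons 0 f - R f))"
proof -
  have f_eq: "ae_eq M (poly_rv X (P n)) (orth_rv M X (int n))" for n
    unfolding P_def by (rule ae_eq_sym[OF orth_rv_eq_jacobi_poly[OF sj' w0]])
  \<comment> \<open>Operators on F respect almost sure equality, so their prescribed values at
    f_n(X) pass to P_n(X).\<close>
  have T_eq: "ae_eq M (T (poly_rv X (P n))) (T (orth_rv M X (int n)))"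
    if "linear_op_on_F M X T" for T n
    using linear_op_on_FD(2)[OF that] f_eq unfolding ae_eq_def orth_rv_def by simp
  have lin: "linear_op_on_F M X ap" "linear_op_on_F M X az" "linear_op_on_F M X am"
    using ap az am by (auto simp: creation_op_def preservation_op_def annihilation_op_def)
  have ap_P: "AE \<omega> in M. ap (poly_rv X (P n)) \<omega> = poly_rv X (P (Suc n)) \<omega>" for n
  proof -
    have "ae_eq M (ap (orth_rv M X (int n))) (orth_rv M X (int (Suc n)))"
      using ap unfolding creation_op_def by (metis of_nat_Suc add.commute)
    thus ?thesis using T_eq[OF lin(1), of n] f_eq[of "Suc n"]
      unfolding ae_eq_def by eventually_elim simp
  qed
  have az_P: "AE \<omega> in M. az (poly_rv X (P n)) \<omega> = of_real (a' n) * poly_rv X (P n) \<omega>" for n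
  proof -
    have "ae_eq M (az (orth_rv M X (int n))) (\<lambda>\<omega>. of_real (a n) * orth_rv M X (int n) \<omega>)"
      using az unfolding preservation_op_def by blast
    thus ?thesis using T_eq[OF lin(2), of n] f_eq[of n] szego_jacobi_unique(1)[OF sj sj', of n]
      unfolding ae_eq_def by eventually_elim simp
  qed
  have am_P: "AE \<omega> in M. am (poly_rv X (P n)) \<omega> = of_real (w' n) * poly_rv X (P (n - 1)) \<omega>" for n
  proof -
    have "ae_eq M (am (orth_rv M X (int n))) (\<lambda>\<omega>. of_real (w n) * orth_rv M X (int n - 1) \<omega>)"
      using am unfolding annihilation_op_def by blast
    moreover have "ae_eq M (\<lambda>\<omega>. of_real (w' n) * orth_rv M X (int n - 1) \<omega>)
        (\<lambda>\<omega>. of_real (w' n) * poly_rv X (P (n - 1)) \<omega>)"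
    proof (cases n)
      case (Suc k)
      hence k: "int n - 1 = int k" by simp
      show ?thesis using f_eq[of k] unfolding ae_eq_def k
        by eventually_elim (simp add: Suc)
    qed (simp add: ae_eq_def w0)
    ultimately show ?thesis using T_eq[OF lin(3), of n] szego_jacobi_unique(2)[OF sj sj', of n]
      unfolding ae_eq_def by eventually_elim simp
  qed
  show "ae_eq M (semi_annihilation am az (poly_rv X f)) (poly_rv X (R f))"
  proof (rule linear_op_on_F_eqI_jacobi_poly[where a = a' and w = w' and R = R and f = f])
    show "linear_op_on_F M X (semi_annihilation am az)"
      unfolding semi_annihilation_def by (rule linear_op_on_F_add_scaled[OF lin(3,2)])
    fix n
    show "ae_eq M (semi_annihilation am az (poly_rv X (jacobi_poly a' w' n)))
        (poly_rv X (R (jacobi_poly a' w' n)))"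
      using am_P[of n] az_P[of n] unfolding ae_eq_def semi_annihilation_def P_def[symmetric] R
      by eventually_elim simp
  qed (fact R_add R_smult)+
  show "ae_eq M (semi_creation ap az (poly_rv X f)) (poly_rv X (pCons 0 f - R f))"
  proof (rule linear_op_on_F_eqI_jacobi_poly[where a = a' and w = w' and f = f
        and R = "\<lambda>f. pCons 0 f - R f"])
    show "linear_op_on_F M X (semi_creation ap az)"
      unfolding semi_creation_def by (rule linear_op_on_F_add_scaled[OF lin(1,2)])
    fix n
    \<comment> \<open>By the recurrence X P_n - R P_n = P_(n+1) + (a'_n / 2) P_n, which is the value
      of \<open>ap\<close> plus half that of \<open>az\<close>.\<close>
    show "ae_eq M (semi_creation ap az (poly_rv X (jacobi_poly a' w' n)))
        (poly_rv X (pCons 0 (jacobi_poly a' w' n) - R (jacobi_poly a' w' n)))"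
      using ap_P[of n] az_P[of n]
      unfolding ae_eq_def semi_creation_def P_def[symmetric] R
        jacobi_poly_Suc[of w' a', OF w0, folded P_def]
      by eventually_elim (simp add: algebra_simps)
  qed (auto simp: R_add R_smult smult_diff_right)
qed

end

section \<open>The explicit formulas for U and V\<close>

theorem mainTheorem1:
  fixes M :: "'a measure" and X :: "'a \<Rightarrow> real"
    and \<alpha> \<alpha>\<^sub>0 \<beta> t \<Delta> \<tau> :: real
    and a w :: "nat \<Rightarrow> real"
    and ap az am U V :: "('a \<Rightarrow> complex) \<Rightarrow> 'a \<Rightarrow> complex"
  assumes "prob_space M"
    and "X \<in> borel_measurable M"
    and "\<And>n::nat. integrable M (\<lambda>\<omega>. X \<omega> ^ n)"
    and "classical_meixner M X \<alpha> \<alpha>\<^sub>0 \<beta> t"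
    and "t > 0"
    and "szego_jacobi M X a w"
    and "creation_op M X ap"
    and "preservation_op M X a az"
    and "annihilation_op M X w am"
  defines "U \<equiv> semi_annihilation am az"
    and "V \<equiv> semi_creation ap az"
    and "\<Delta> \<equiv> \<alpha>\<^sup>2 - 4 * \<beta>"
    and "\<tau> \<equiv> 2 * t - \<alpha> * \<alpha>\<^sub>0"
  shows
    "(\<Delta> = 0 \<longrightarrow>
       (\<forall>f :: complex poly.
          ae_eq M (U (poly_rv X f))
            (\<lambda>\<omega>. of_real (\<alpha>\<^sub>0 / 2) * poly_rv X f \<omega>
                  + 1/2 * of_real (\<alpha> * X \<omega> + \<tau>) * poly_rv X (pderiv f) \<omega>) \<and>
          ae_eq M (V (poly_rv X f))
            (\<lambda>\<omega>. of_real (X \<omega> - \<alpha>\<^sub>0 / 2) * poly_rv X f \<omega>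
                  - 1/2 * of_real (\<alpha> * X \<omega> + \<tau>) * poly_rv X (pderiv f) \<omega>)))
     \<and>
     (\<Delta> \<noteq> 0 \<longrightarrow>
       (\<forall>\<delta> :: complex. \<delta>\<^sup>2 = of_real \<Delta> \<longrightarrow>
         (\<forall>f :: complex poly.
            ae_eq M (U (poly_rv X f))
              (\<lambda>\<omega>. of_real (\<alpha>\<^sub>0 / 2) * poly_rv X f \<omega>
                    - 1/4 * of_real (X \<omega> - \<alpha>\<^sub>0)
                        * (poly_rv X (translate \<delta> f) \<omega> + poly_rv X (translate (- \<delta>) f) \<omega>
                            - 2 * poly_rv X f \<omega>)
                    + 1 / (4 * \<delta>) * of_real (\<alpha> * X \<omega> + \<tau>)
                        * (poly_rv X (translate \<delta> f) \<omega> - poly_rv X (translate (- \<delta>) f) \<omega>)) \<and>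
            ae_eq M (V (poly_rv X f))
              (\<lambda>\<omega>. of_real (X \<omega>) * poly_rv X f \<omega> - of_real (\<alpha>\<^sub>0 / 2) * poly_rv X f \<omega>
                    + 1/4 * of_real (X \<omega> - \<alpha>\<^sub>0)
                        * (poly_rv X (translate \<delta> f) \<omega> + poly_rv X (translate (- \<delta>) f) \<omega>
                            - 2 * poly_rv X f \<omega>)
                    - 1 / (4 * \<delta>) * of_real (\<alpha> * X \<omega> + \<tau>)
                        * (poly_rv X (translate \<delta> f) \<omega> - poly_rv X (translate (- \<delta>) f) \<omega>)))))"
proof -
  interpret prob_space M by fact
  interpret rv_all_moments M X by unfold_locales fact+
  have sj: "szego_jacobi M X (meixner_a \<alpha> \<alpha>\<^sub>0) (meixner_w \<beta> t)"
    by (rule classical_meixner_szego_jacobi) fact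
  have w0: "meixner_w \<beta> t 0 = 0" by (simp add: meixner_w_def)
  note semi_ops = semi_operators_eqI[OF assms(6) sj w0 assms(7-9)]
  note defs = U_def V_def \<Delta>_def \<tau>_def
  show ?thesis
  proof (intro conjI impI allI)
    fix f :: "complex poly"
    assume "\<Delta> = 0"
    let ?R = "meixner_diff_op \<alpha> \<alpha>\<^sub>0 \<tau>"
    have lin: "?R (f + g) = ?R f + ?R g" "?R (smult c f) = smult c (?R f)" for f g c
      unfolding meixner_diff_op_def
      by (rule poly_ext; simp add: pderiv_add pderiv_smult algebra_simps)+
    have R: "?R (meixner_poly \<alpha> \<alpha>\<^sub>0 \<beta> t n)
        = smult (of_real (meixner_w \<beta> t n)) (meixner_poly \<alpha> \<alpha>\<^sub>0 \<beta> t (n - 1))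
          + smult (of_real (meixner_a \<alpha> \<alpha>\<^sub>0 n / 2)) (meixner_poly \<alpha> \<alpha>\<^sub>0 \<beta> t n)" for n
      using meixner_diff_op_jacobi_poly[of \<alpha> \<beta> \<alpha>\<^sub>0 t] \<open>\<Delta> = 0\<close> by (simp add: \<Delta>_def \<tau>_def)
    show "ae_eq M (U (poly_rv X f)) (\<lambda>\<omega>. of_real (\<alpha>\<^sub>0 / 2) * poly_rv X f \<omega>
        + 1/2 * of_real (\<alpha> * X \<omega> + \<tau>) * poly_rv X (pderiv f) \<omega>)"
      using semi_ops(1)[of ?R f, OF lin R] unfolding U_def ae_eq_def meixner_diff_op_def
      by eventually_elim (simp add: algebra_simps)
    show "ae_eq M (V (poly_rv X f)) (\<lambda>\<omega>. of_real (X \<omega> - \<alpha>\<^sub>0 / 2) * poly_rv X f \<omega>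
        - 1/2 * of_real (\<alpha> * X \<omega> + \<tau>) * poly_rv X (pderiv f) \<omega>)"
      using semi_ops(2)[of ?R f, OF lin R] unfolding V_def ae_eq_def meixner_diff_op_def
      by eventually_elim (simp add: algebra_simps)
  next
    fix \<delta> :: complex and f :: "complex poly"
    assume "\<Delta> \<noteq> 0" "\<delta>\<^sup>2 = of_real \<Delta>"
    let ?R = "meixner_shift_op \<alpha> \<alpha>\<^sub>0 \<tau> \<delta>"
    have lin: "?R (f + g) = ?R f + ?R g" "?R (smult c f) = smult c (?R f)" for f g c
      unfolding meixner_shift_op_def by (rule poly_ext; simp add: algebra_simps)+
    have R: "?R (meixner_poly \<alpha> \<alpha>\<^sub>0 \<beta> t n)
        = smult (of_real (meixner_w \<beta> t n)) (meixner_poly \<alpha> \<alpha>\<^sub>0 \<beta> t (n - 1))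
          + smult (of_real (meixner_a \<alpha> \<alpha>\<^sub>0 n / 2)) (meixner_poly \<alpha> \<alpha>\<^sub>0 \<beta> t n)" for n
      using meixner_shift_op_jacobi_poly[of \<alpha> \<beta> \<delta> \<alpha>\<^sub>0 t] \<open>\<Delta> \<noteq> 0\<close> \<open>\<delta>\<^sup>2 = of_real \<Delta>\<close>
      by (simp add: \<Delta>_def \<tau>_def)
    \<comment> \<open>Keeps each linear coefficient as one real number cast to the complex numbers,
      the form in which the goal states it.\<close>
    have lin_poly: "poly_rv X [:of_real c, of_real d:] \<omega> = of_real (d * X \<omega> + c)"
      "poly_rv X [:- of_real c, 1:] \<omega> = of_real (X \<omega> - c)" for c d :: real and \<omega>
      by (simp_all add: algebra_simps)
    note expand = meixner_shift_op_def poly_rv_simps(3-6) lin_poly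
    show "ae_eq M (U (poly_rv X f))
      (\<lambda>\<omega>. of_real (\<alpha>\<^sub>0 / 2) * poly_rv X f \<omega>
        - 1/4 * of_real (X \<omega> - \<alpha>\<^sub>0)
            * (poly_rv X (translate \<delta> f) \<omega> + poly_rv X (translate (- \<delta>) f) \<omega>
                - 2 * poly_rv X f \<omega>)
        + 1 / (4 * \<delta>) * of_real (\<alpha> * X \<omega> + \<tau>)
            * (poly_rv X (translate \<delta> f) \<omega> - poly_rv X (translate (- \<delta>) f) \<omega>))"
      using semi_ops(1)[of ?R f, OF lin R] unfolding U_def ae_eq_def expand
      by eventually_elim (simp only: mult.assoc)
    show "ae_eq M (V (poly_rv X f))
      (\<lambda>\<omega>. of_real (X \<omega>) * poly_rv X f \<omega> - of_real (\<alpha>\<^sub>0 / 2) * poly_rv X f \<omega>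
        + 1/4 * of_real (X \<omega> - \<alpha>\<^sub>0)
            * (poly_rv X (translate \<delta> f) \<omega> + poly_rv X (translate (- \<delta>) f) \<omega>
                - 2 * poly_rv X f \<omega>)
        - 1 / (4 * \<delta>) * of_real (\<alpha> * X \<omega> + \<tau>)
            * (poly_rv X (translate \<delta> f) \<omega> - poly_rv X (translate (- \<delta>) f) \<omega>))"
      using semi_ops(2)[of ?R f, OF lin R] unfolding V_def ae_eq_def expand
      by eventually_elim (simp only: poly_rv_simps(7) mult.assoc, simp)
  qed
qed

end
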